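(* Let $G$ and $H$ be graphs. Then $G$ and $H$ are strongly relationally equivalent if and only if their thin graphs $G_{\mathrm{thin}}$ and $H_{\mathrm{thin}}$ are isomorphic.
   Context: Graphs are finite and undirected, with loops allowed: $G=(V_G,E_G)$ with $E_G\subseteq V_G\times V_G$ symmetric. A relation $R\subseteq X\times Y$ has full domain if every $x\in X$ is related to some $p\in Y$, and full image if every $p\in Y$ is related to by some $x\in X$. For a graph $G$, a finite set $B$ and a relation $R\subseteq V_G\times B$ with full image, $G\ast R$ is the graph with vertex set $B$ and edge set $\{(u,v)\in B\times B : \text{there is } (x,y)\in E_G \text{ with } (x,u),(y,v)\in R\}$. The equation $G\ast R=H$ means that $R\subseteq V_G\times V_H$ has full image and $G\ast R$ equals $H$ as a graph. The transpose of $R$ is $R^+=\{(u,x):(x,u)\in R\}$. Graphs $G$ and $H$ are strongly relationally equivalent if there is a relation $R\subseteq V_G\times V_H$ with full domain such that $G\ast R=H$ and $H\ast R^+=G$. Let $N_G(x)=\{z\in V_G:(x,z)\in E_G\}$. The thinness relation $S$ of $G$ is the equivalence relation on $V_G$ with $(x,y)\in S$ iff $N_G(x)=N_G(y)$. The thin graph $G_{\mathrm{thin}}$ is the quotient graph $G/S$: its vertices are the $S$-equivalence classes, and classes $\sigma,\tau$ are adjacent (possibly $\sigma=\tau$, giving a loop) iff there is $(x,y)\in E_G$ with $x\in\sigma$, $y\in\tau$. *)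

theory Defs
  imports "Graph_Theory.Graph_Theory"
begin

text \<open>
  A finite undirected graph with loops allowed is a \<^locale>\<open>pair_pseudo_graph\<close>: a finite vertex
  set \<^const>\<open>pverts\<close> together with a symmetric set \<^const>\<open>parcs\<close> of pairs of vertices.  The empty
  graph is allowed.
\<close>

definition full_domain_on :: "'a set \<Rightarrow> 'b set \<Rightarrow> ('a \<times> 'b) set \<Rightarrow> bool" where
  "full_domain_on X Y R \<longleftrightarrow> (\<forall>x\<in>X. \<exists>p\<in>Y. (x, p) \<in> R)"

definition full_image_on :: "'a set \<Rightarrow> 'b set \<Rightarrow> ('a \<times> 'b) set \<Rightarrow> bool" where
  "full_image_on X Y R \<longleftrightarrow> (\<forall>p\<in>Y. \<exists>x\<in>X. (x, p) \<in> R)"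

text \<open>
  The graph \<open>G \<^bold>* R\<close>.  The target set \<open>B\<close> is an explicit argument, since it is part of the
  typing of the relation and is not determined by the set of pairs \<open>R\<close> alone.
\<close>

definition rel_graph ::
  "'a pair_pre_digraph \<Rightarrow> ('a \<times> 'b) set \<Rightarrow> 'b set \<Rightarrow> 'b pair_pre_digraph" where
  "rel_graph G R B =
     \<lparr> pverts = B,
       parcs = {(u, v) \<in> B \<times> B. \<exists>x y. (x, y) \<in> parcs G \<and> (x, u) \<in> R \<and> (y, v) \<in> R} \<rparr>"

text \<open>The equation \<open>G \<^bold>* R = H\<close>, including its side conditions on \<open>R\<close>.\<close>

definition rel_graph_eq ::
  "'a pair_pre_digraph \<Rightarrow> ('a \<times> 'b) set \<Rightarrow> 'b pair_pre_digraph \<Rightarrow> bool" where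
  "rel_graph_eq G R H \<longleftrightarrow>
     R \<subseteq> pverts G \<times> pverts H \<and> full_image_on (pverts G) (pverts H) R \<and>
     rel_graph G R (pverts H) = H"

definition strongly_rel_equivalent ::
  "'a pair_pre_digraph \<Rightarrow> 'b pair_pre_digraph \<Rightarrow> bool" where
  "strongly_rel_equivalent G H \<longleftrightarrow>
     (\<exists>R. R \<subseteq> pverts G \<times> pverts H \<and> full_domain_on (pverts G) (pverts H) R \<and>
          rel_graph_eq G R H \<and> rel_graph_eq H (R\<inverse>) G)"

definition neighbourhood :: "'a pair_pre_digraph \<Rightarrow> 'a \<Rightarrow> 'a set" where
  "neighbourhood G x = {z \<in> pverts G. (x, z) \<in> parcs G}"

definition thinness_rel :: "'a pair_pre_digraph \<Rightarrow> 'a rel" where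
  "thinness_rel G = {(x, y) \<in> pverts G \<times> pverts G. neighbourhood G x = neighbourhood G y}"

definition thin_graph :: "'a pair_pre_digraph \<Rightarrow> 'a set pair_pre_digraph" where
  "thin_graph G =
     \<lparr> pverts = pverts G // thinness_rel G,
       parcs = {(\<sigma>, \<tau>) \<in> (pverts G // thinness_rel G) \<times> (pverts G // thinness_rel G).
                  \<exists>x\<in>\<sigma>. \<exists>y\<in>\<tau>. (x, y) \<in> parcs G} \<rparr>"

lemma equiv_thinness_rel: "equiv (pverts G) (thinness_rel G)"
  by (auto simp: equiv_def refl_on_def sym_def trans_def thinness_rel_def)

text \<open>
  Isomorphism is \<^const>\<open>digraph_iso\<close>, applied to pair graphs via \<^const>\<open>with_proj\<close>.  The lemma
  below confirms that on pair graphs it is the usual notion: a bijection of the vertex sets that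
  preserves and reflects adjacency.
\<close>

lemma digraph_iso_with_proj_iff:
  assumes "pair_wf_digraph G" "pair_wf_digraph H"
  shows "digraph_iso (with_proj G) (with_proj H) \<longleftrightarrow>
    (\<exists>f. bij_betw f (pverts G) (pverts H) \<and>
         (\<forall>x\<in>pverts G. \<forall>y\<in>pverts G. (x, y) \<in> parcs G \<longleftrightarrow> (f x, f y) \<in> parcs H))"
    (is "?L \<longleftrightarrow> ?R")
proof
  assume ?L
  then obtain f where f: "pre_digraph.digraph_isomorphism (with_proj G) f"
    and H: "with_proj H = app_iso f (with_proj G)"
    by (auto simp: digraph_iso_def)
  let ?v = "iso_verts f" and ?a = "iso_arcs f"
  have vH: "pverts H = ?v ` pverts G" and aH: "parcs H = ?a ` parcs G"
    and tl: "iso_tail f = fst" and hd: "iso_head f = snd"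
    using H by (auto simp: with_proj_def app_iso_def)
  have inj: "inj_on ?v (pverts G)"
    and ends: "\<And>e. e \<in> parcs G \<Longrightarrow> ?a e = (?v (fst e), ?v (snd e))"
    using f tl hd by (auto simp: pre_digraph.digraph_isomorphism_def prod_eq_iff)
  have "(x, y) \<in> parcs G \<longleftrightarrow> (?v x, ?v y) \<in> parcs H"
    if xy: "x \<in> pverts G" "y \<in> pverts G" for x y
  proof
    assume e: "(x, y) \<in> parcs G"
    have "?a (x, y) \<in> parcs H" unfolding aH using e by (rule imageI)
    then show "(?v x, ?v y) \<in> parcs H" using ends[OF e] by simp
  next
    assume "(?v x, ?v y) \<in> parcs H"
    then obtain e where e: "e \<in> parcs G" "(?v x, ?v y) = ?a e" using aH by auto
    then have "?v x = ?v (fst e)" "?v y = ?v (snd e)" using ends by auto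
    moreover have "fst e \<in> pverts G" "snd e \<in> pverts G"
      using e(1) by (simp_all add: pair_wf_digraph.arc_fst_in_verts[OF assms(1)]
          pair_wf_digraph.arc_snd_in_verts[OF assms(1)])
    ultimately have "x = fst e" "y = snd e" using inj xy by (auto dest: inj_onD)
    then show "(x, y) \<in> parcs G" using e by simp
  qed
  then show ?R using inj vH by (intro exI[of _ ?v]) (auto simp: bij_betw_def)
next
  assume ?R
  then obtain f where bij: "bij_betw f (pverts G) (pverts H)"
    and adj: "\<And>x y. x \<in> pverts G \<Longrightarrow> y \<in> pverts G \<Longrightarrow> (x, y) \<in> parcs G \<longleftrightarrow> (f x, f y) \<in> parcs H"
    by blast
  note wf = pair_wf_digraph.in_arcsD1[OF assms(1)] pair_wf_digraph.in_arcsD2[OF assms(1)]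
    pair_wf_digraph.in_arcsD1[OF assms(2)] pair_wf_digraph.in_arcsD2[OF assms(2)]
  have inj: "inj_on f (pverts G)" and img: "f ` pverts G = pverts H"
    using bij by (auto simp: bij_betw_def)
  let ?h = "\<lparr> iso_verts = f, iso_arcs = map_prod f f, iso_head = snd, iso_tail = fst \<rparr>"
  have arcs: "map_prod f f ` parcs G = parcs H"
  proof (intro equalityI subsetI)
    fix e assume "e \<in> map_prod f f ` parcs G"
    then obtain x y where xy: "(x, y) \<in> parcs G" "e = (f x, f y)" by auto
    then show "e \<in> parcs H" using adj[OF wf(1,2)] by blast
  next
    fix e assume e: "e \<in> parcs H"
    obtain u v where uv: "e = (u, v)" by (cases e)
    have "u \<in> f ` pverts G" "v \<in> f ` pverts G"
      unfolding img using wf(3,4) e uv by blast+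
    then obtain x y where xy: "x \<in> pverts G" "y \<in> pverts G" "u = f x" "v = f y"
      by blast
    then have "(x, y) \<in> parcs G" using adj e uv by blast
    then have "map_prod f f (x, y) \<in> map_prod f f ` parcs G" by (rule imageI)
    then show "e \<in> map_prod f f ` parcs G" using uv xy by simp
  qed
  have "inj_on (map_prod f f) (pverts G \<times> pverts G)"
    using map_prod_inj_on[OF inj inj] .
  moreover have "parcs G \<subseteq> pverts G \<times> pverts G"
    using wf(1,2) by (intro subrelI) blast
  ultimately have "inj_on (map_prod f f) (parcs G)" by (rule inj_on_subset)
  moreover have "wf_digraph (with_proj G)"
    using pair_wf_digraph.arc_fst_in_verts[OF assms(1)] pair_wf_digraph.arc_snd_in_verts[OF assms(1)]
    by (intro wf_digraph.intro) simp_all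
  ultimately have "pre_digraph.digraph_isomorphism (with_proj G) ?h"
    using inj by (auto simp: pre_digraph.digraph_isomorphism_def)
  moreover have "with_proj H = app_iso ?h (with_proj G)"
    using arcs img by (simp add: with_proj_def app_iso_def)
  ultimately show ?L by (auto simp: digraph_iso_def)
qed

end

theory Submission
  imports Defs
begin

text \<open>
  On graphs without dangling edges, a relation witnesses strong relational equivalence iff it is
  total on both sides and every two related pairs preserve and reflect adjacency.  Such a relation
  maps thinness classes onto thinness classes, and its converse undoes this.  Conversely, an
  isomorphism of the thin graphs pulls back along the two projections to such a relation, because
  adjacency of vertices depends only on their thinness classes.
\<close>

text \<open>The last clause ranges over all related pairs, whereas \<open>rel_graph\<close> asks
  only for some preimages. This makes the notion self-dual under converse, so each fact about
  \<open>R\<close> is also available for \<open>R\<inverse>\<close>.\<close>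

definition adjacency_correspondence ::
  "'a pair_pre_digraph \<Rightarrow> 'b pair_pre_digraph \<Rightarrow> ('a \<times> 'b) set \<Rightarrow> bool" where
  "adjacency_correspondence G H R \<longleftrightarrow>
     R \<subseteq> pverts G \<times> pverts H \<and>
     full_domain_on (pverts G) (pverts H) R \<and> full_image_on (pverts G) (pverts H) R \<and>
     (\<forall>x u y v. (x, u) \<in> R \<longrightarrow> (y, v) \<in> R \<longrightarrow> ((x, y) \<in> parcs G \<longleftrightarrow> (u, v) \<in> parcs H))"

lemma adjacency_correspondenceD:
  assumes "adjacency_correspondence G H R"
  shows "\<And>x u. (x, u) \<in> R \<Longrightarrow> x \<in> pverts G"
    and "\<And>x u. (x, u) \<in> R \<Longrightarrow> u \<in> pverts H"
    and "\<And>x. x \<in> pverts G \<Longrightarrow> \<exists>u. (x, u) \<in> R"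
    and "\<And>u. u \<in> pverts H \<Longrightarrow> \<exists>x. (x, u) \<in> R"
    and "\<And>x u y v. (x, u) \<in> R \<Longrightarrow> (y, v) \<in> R \<Longrightarrow> (x, y) \<in> parcs G \<longleftrightarrow> (u, v) \<in> parcs H"
  using assms
  unfolding adjacency_correspondence_def full_domain_on_def full_image_on_def by blast+

lemma adjacency_correspondence_converse:
  "adjacency_correspondence G H R \<Longrightarrow> adjacency_correspondence H G (R\<inverse>)"
  unfolding adjacency_correspondence_def full_domain_on_def full_image_on_def by blast

lemma rel_graph_eq_self_iff:
  "rel_graph G R (pverts H) = H \<longleftrightarrow>
    (\<forall>u v. (u, v) \<in> parcs H \<longleftrightarrow> u \<in> pverts H \<and> v \<in> pverts H \<and>
       (\<exists>x y. (x, y) \<in> parcs G \<and> (x, u) \<in> R \<and> (y, v) \<in> R))"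
  by (cases H) (auto simp: rel_graph_def)

text \<open>For related pairs, the equation producing \<open>H\<close> carries arcs of
  \<open>G\<close> to arcs of \<open>H\<close>, and the equation producing \<open>G\<close> carries
  them back. Conversely, totality supplies the preimages of the two ends of an arc that
  \<open>rel_graph\<close> demands.\<close>

lemma strongly_rel_equivalent_iff:
  assumes "pair_wf_digraph G" "pair_wf_digraph H"
  shows "strongly_rel_equivalent G H \<longleftrightarrow> (\<exists>R. adjacency_correspondence G H R)"
proof
  assume "strongly_rel_equivalent G H"
  then obtain R where R: "R \<subseteq> pverts G \<times> pverts H"
    "full_domain_on (pverts G) (pverts H) R" "full_image_on (pverts G) (pverts H) R"
    "rel_graph G R (pverts H) = H" "rel_graph H (R\<inverse>) (pverts G) = G"
    unfolding strongly_rel_equivalent_def rel_graph_eq_def by blast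
  from R(4,5) have "(x, y) \<in> parcs G \<longleftrightarrow> (u, v) \<in> parcs H"
    if "(x, u) \<in> R" "(y, v) \<in> R" for x u y v
    unfolding rel_graph_eq_self_iff using that R(1) by blast
  with R have "adjacency_correspondence G H R"
    unfolding adjacency_correspondence_def by blast
  then show "\<exists>R. adjacency_correspondence G H R" ..
next
  \<comment> \<open>Stated with fresh type variables because it is applied both to \<open>R\<close>
    and to \<open>R\<inverse>\<close>, where the vertex types are swapped.\<close>
  have eq: "rel_graph G' R' (pverts H') = H'"
    if "pair_wf_digraph H'" and corr: "adjacency_correspondence G' H' R'"
    for G' :: "'c pair_pre_digraph" and H' :: "'d pair_pre_digraph" and R'
  proof -
    have "u \<in> pverts H' \<and> v \<in> pverts H'" if "(u, v) \<in> parcs H'" for u v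
      using pair_wf_digraph.in_arcsD1[OF \<open>pair_wf_digraph H'\<close> that]
        pair_wf_digraph.in_arcsD2[OF \<open>pair_wf_digraph H'\<close> that] by blast
    then show ?thesis
      unfolding rel_graph_eq_self_iff using adjacency_correspondenceD(4,5)[OF corr] by metis
  qed
  assume "\<exists>R. adjacency_correspondence G H R"
  then obtain R where R: "adjacency_correspondence G H R" ..
  note R' = adjacency_correspondence_converse[OF R]
  show "strongly_rel_equivalent G H"
    using R R' eq[OF assms(2) R] eq[OF assms(1) R']
    unfolding strongly_rel_equivalent_def rel_graph_eq_def adjacency_correspondence_def by blast
qed

text \<open>Every vertex \<open>v\<close> of \<open>H\<close> has a preimage \<open>y\<close>.
  Whether \<open>u\<close> or \<open>u'\<close> is adjacent to \<open>v\<close> is thus decided by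
  whether \<open>x\<close> or \<open>x'\<close> is adjacent to \<open>y\<close>, and these two
  answers agree.\<close>

lemma adjacency_correspondence_thinness:
  assumes "adjacency_correspondence G H R" "(x, u) \<in> R" "(x', u') \<in> R"
    and "(x, x') \<in> thinness_rel G"
  shows "(u, u') \<in> thinness_rel H"
proof -
  note D = adjacency_correspondenceD[OF assms(1)]
  have nb: "(x, y) \<in> parcs G \<longleftrightarrow> (x', y) \<in> parcs G" if "y \<in> pverts G" for y
    using assms(4) that by (auto simp: thinness_rel_def neighbourhood_def)
  have "(u, v) \<in> parcs H \<longleftrightarrow> (u', v) \<in> parcs H" if v: "v \<in> pverts H" for v
  proof -
    obtain y where y: "(y, v) \<in> R" using D(4)[OF v] ..
    show ?thesis using D(5)[OF assms(2) y] D(5)[OF assms(3) y] nb[OF D(1)[OF y]] by blast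
  qed
  then show ?thesis
    using D(2)[OF assms(2)] D(2)[OF assms(3)] by (auto simp: thinness_rel_def neighbourhood_def)
qed

lemma adjacency_correspondence_Image_class:
  assumes "adjacency_correspondence G H R" "(x, u) \<in> R"
  shows "R `` (thinness_rel G `` {x}) = thinness_rel H `` {u}"
proof (intro equalityI subsetI)
  fix u' assume "u' \<in> R `` (thinness_rel G `` {x})"
  then show "u' \<in> thinness_rel H `` {u}"
    using adjacency_correspondence_thinness[OF assms] by blast
next
  fix u' assume "u' \<in> thinness_rel H `` {u}"
  then have u': "(u, u') \<in> thinness_rel H" by simp
  then have "u' \<in> pverts H" by (simp add: thinness_rel_def)
  then obtain x' where x': "(x', u') \<in> R"
    using adjacency_correspondenceD(4)[OF assms(1)] by blast
  \<comment> \<open>Thinness is pulled back to \<open>G\<close> by transporting it along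
    \<open>R\<inverse>\<close>.\<close>
  have "(x, x') \<in> thinness_rel G"
    using adjacency_correspondence_thinness[OF adjacency_correspondence_converse[OF assms(1)]]
      assms(2) x' u' by blast
  with x' show "u' \<in> R `` (thinness_rel G `` {x})" by blast
qed

text \<open>Although \<open>R\<close> need not be a function on vertices, taking images under it is
  one on thinness classes. Applied to \<open>R\<close> and to \<open>R\<inverse>\<close>, the lemma
  yields two mutually inverse maps.\<close>

lemma adjacency_correspondence_Image_quotient:
  assumes "adjacency_correspondence G H R" "\<sigma> \<in> pverts G // thinness_rel G"
  shows "R `` \<sigma> \<in> pverts H // thinness_rel H" "R\<inverse> `` (R `` \<sigma>) = \<sigma>"
proof -
  obtain x where x: "x \<in> pverts G" "\<sigma> = thinness_rel G `` {x}"
    using assms(2) by (auto elim: quotientE)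
  obtain u where u: "(x, u) \<in> R" using adjacency_correspondenceD(3)[OF assms(1) x(1)] ..
  have eq: "R `` \<sigma> = thinness_rel H `` {u}"
    unfolding x(2) by (rule adjacency_correspondence_Image_class[OF assms(1) u])
  then show "R `` \<sigma> \<in> pverts H // thinness_rel H"
    using adjacency_correspondenceD(2)[OF assms(1) u] by (simp add: quotientI)
  have "R\<inverse> `` (thinness_rel H `` {u}) = thinness_rel G `` {x}"
    by (rule adjacency_correspondence_Image_class[OF adjacency_correspondence_converse[OF assms(1)]])
      (use u in simp)
  then show "R\<inverse> `` (R `` \<sigma>) = \<sigma>" using eq x(2) by simp
qed

lemma pverts_thin_graph: "pverts (thin_graph G) = pverts G // thinness_rel G"
  by (simp add: thin_graph_def)

lemma pair_wf_digraph_thin_graph: "pair_wf_digraph (thin_graph G)"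
  by unfold_locales (auto simp: thin_graph_def)

text \<open>An arc between classes only promises some adjacent representatives. Equal neighbourhoods
  allow the first end of an arc to be exchanged; symmetry of \<open>G\<close> turns the arc around
  so that the second end can be exchanged too.\<close>

lemma thin_graph_class_arc_iff:
  assumes "pair_pseudo_graph G" "x \<in> pverts G" "y \<in> pverts G"
  shows "(thinness_rel G `` {x}, thinness_rel G `` {y}) \<in> parcs (thin_graph G) \<longleftrightarrow>
    (x, y) \<in> parcs G"
proof
  interpret pair_pseudo_graph G by fact
  assume "(thinness_rel G `` {x}, thinness_rel G `` {y}) \<in> parcs (thin_graph G)"
  then obtain x' y' where xy': "(x, x') \<in> thinness_rel G" "(y, y') \<in> thinness_rel G"
    "(x', y') \<in> parcs G" by (auto simp: thin_graph_def)
  then have "y' \<in> neighbourhood G x'"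
    by (auto simp: neighbourhood_def thinness_rel_def)
  then have "(x, y') \<in> parcs G"
    using xy'(1) by (auto simp: neighbourhood_def thinness_rel_def)
  then have "x \<in> neighbourhood G y'"
    using assms(2) by (auto simp: neighbourhood_def intro: arcs_symmetric)
  then have "(y, x) \<in> parcs G"
    using xy'(2) by (auto simp: neighbourhood_def thinness_rel_def)
  then show "(x, y) \<in> parcs G" by (rule arcs_symmetric)
next
  assume "(x, y) \<in> parcs G"
  then show "(thinness_rel G `` {x}, thinness_rel G `` {y}) \<in> parcs (thin_graph G)"
    using quotientI[OF assms(2)] quotientI[OF assms(3)]
      equiv_class_self[OF equiv_thinness_rel assms(2)] equiv_class_self[OF equiv_thinness_rel assms(3)]
    unfolding thin_graph_def by fastforce
qed

theorem theorem3p8: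
  fixes G :: "'a pair_pre_digraph" and H :: "'b pair_pre_digraph"
  assumes "pair_pseudo_graph G" and "pair_pseudo_graph H"
  shows "strongly_rel_equivalent G H \<longleftrightarrow>
         digraph_iso (with_proj (thin_graph G)) (with_proj (thin_graph H))"
proof -
  interpret G: pair_pseudo_graph G by fact
  interpret H: pair_pseudo_graph H by fact
  let ?S = "thinness_rel G" and ?T = "thinness_rel H"
  note iso_iff = digraph_iso_with_proj_iff
    [OF pair_wf_digraph_thin_graph[of G] pair_wf_digraph_thin_graph[of H],
      unfolded pverts_thin_graph]
  note equivalent_iff =
    strongly_rel_equivalent_iff[OF G.pair_wf_digraph_axioms H.pair_wf_digraph_axioms]
  show ?thesis
  proof
    assume "strongly_rel_equivalent G H"
    then obtain R where R: "adjacency_correspondence G H R"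
      unfolding equivalent_iff ..
    note D = adjacency_correspondenceD[OF R]
    note img = adjacency_correspondence_Image_quotient[OF R]
    note img' = adjacency_correspondence_Image_quotient[OF adjacency_correspondence_converse[OF R],
        unfolded converse_converse]
    have "bij_betw ((``) R) (pverts G // ?S) (pverts H // ?T)"
      by (rule bij_betw_byWitness[where f' = "(``) (R\<inverse>)"]) (use img img' in auto)
    moreover have "(\<sigma>, \<tau>) \<in> parcs (thin_graph G) \<longleftrightarrow> (R `` \<sigma>, R `` \<tau>) \<in> parcs (thin_graph H)"
      if \<sigma>: "\<sigma> \<in> pverts G // ?S" and \<tau>: "\<tau> \<in> pverts G // ?S" for \<sigma> \<tau>
    proof -
      obtain x where x: "x \<in> pverts G" "\<sigma> = ?S `` {x}" using \<sigma> by (auto elim: quotientE)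
      obtain y where y: "y \<in> pverts G" "\<tau> = ?S `` {y}" using \<tau> by (auto elim: quotientE)
      obtain u where u: "(x, u) \<in> R" using D(3)[OF x(1)] ..
      obtain v where v: "(y, v) \<in> R" using D(3)[OF y(1)] ..
      \<comment> \<open>With representatives chosen in both graphs, adjacency of classes reduces to
        adjacency of \<open>x\<close>, \<open>y\<close> on one side and of \<open>u\<close>,
        \<open>v\<close> on the other.\<close>
      have "R `` \<sigma> = ?T `` {u}" "R `` \<tau> = ?T `` {v}"
        unfolding x(2) y(2) using adjacency_correspondence_Image_class[OF R] u v by blast+
      then show ?thesis
        using thin_graph_class_arc_iff[OF assms(1) x(1) y(1)] D(5)[OF u v] x(2) y(2)
          thin_graph_class_arc_iff[OF assms(2) D(2)[OF u] D(2)[OF v]] by simp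
    qed
    ultimately show "digraph_iso (with_proj (thin_graph G)) (with_proj (thin_graph H))"
      unfolding iso_iff by blast
  next
    assume "digraph_iso (with_proj (thin_graph G)) (with_proj (thin_graph H))"
    then obtain f where bij: "bij_betw f (pverts G // ?S) (pverts H // ?T)"
      and adj: "\<And>\<sigma> \<tau>. \<sigma> \<in> pverts G // ?S \<Longrightarrow> \<tau> \<in> pverts G // ?S \<Longrightarrow>
        (\<sigma>, \<tau>) \<in> parcs (thin_graph G) \<longleftrightarrow> (f \<sigma>, f \<tau>) \<in> parcs (thin_graph H)"
      unfolding iso_iff by blast
    \<comment> \<open>Each \<open>x\<close> is related to every vertex of the class that
      \<open>f\<close> assigns to its own class, so that all vertices of \<open>H\<close> are
      reached even when classes matched by \<open>f\<close> differ in size.\<close>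
    define R where "R = {(x, u) \<in> pverts G \<times> pverts H. f (?S `` {x}) = ?T `` {u}}"
    have "\<exists>u\<in>pverts H. (x, u) \<in> R" if x: "x \<in> pverts G" for x
    proof -
      have "f (?S `` {x}) \<in> pverts H // ?T" using bij_betwE[OF bij] quotientI[OF x] by blast
      then show ?thesis using x by (auto simp: R_def elim!: quotientE)
    qed
    moreover have "\<exists>x\<in>pverts G. (x, u) \<in> R" if u: "u \<in> pverts H" for u
    proof -
      \<comment> \<open>Surjectivity of \<open>f\<close> gives a class over that of
        \<open>u\<close>; any representative of it is related to \<open>u\<close>.\<close>
      have "?T `` {u} \<in> f ` (pverts G // ?S)"
        using bij_betw_imp_surj_on[OF bij] quotientI[OF u] by blast
      then obtain \<sigma> where "\<sigma> \<in> pverts G // ?S" "f \<sigma> = ?T `` {u}" by auto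
      then show ?thesis using u by (auto simp: R_def elim!: quotientE)
    qed
    moreover have "(x, y) \<in> parcs G \<longleftrightarrow> (u, v) \<in> parcs H"
      if "(x, u) \<in> R" "(y, v) \<in> R" for x u y v
    proof -
      have V: "x \<in> pverts G" "y \<in> pverts G" "u \<in> pverts H" "v \<in> pverts H"
        and f: "f (?S `` {x}) = ?T `` {u}" "f (?S `` {y}) = ?T `` {v}"
        using that by (auto simp: R_def)
      show ?thesis
        using adj[OF quotientI[OF V(1)] quotientI[OF V(2)]] unfolding f
          thin_graph_class_arc_iff[OF assms(1) V(1,2)] thin_graph_class_arc_iff[OF assms(2) V(3,4)] .
    qed
    moreover have "R \<subseteq> pverts G \<times> pverts H" by (auto simp: R_def)
    ultimately have "adjacency_correspondence G H R"
      unfolding adjacency_correspondence_def full_domain_on_def full_image_on_def by blast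
    then show "strongly_rel_equivalent G H" unfolding equivalent_iff ..
  qed
qed

end
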